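(* Let $n\ge k\ge 0$ be integers with $n-k\equiv 0\pmod 2$. Then $$T_{n,k}(x,x^2,\dots,x^{n-k+1})=x^{n}\,T_{n,k}(1,1,\dots,1)$$ and $$T_{n,k}(1,1,\dots,1)=T(n,k)=B_{n,k}\Big(1,0,\frac{1}{2^2},0,\dots,\frac{1}{2^{n-k}}\Big)$$ $$=\sum\frac{n!}{i_1!\,i_3!\cdots i_{n-k+1}!}\Big(\frac{1}{1!}\Big)^{i_1}\Big(\frac{1}{2^2\,3!}\Big)^{i_3}\cdots\Big(\frac{1}{2^{n-k}(n-k+1)!}\Big)^{i_{n-k+1}},$$ where the arguments of $B_{n,k}$ are $x_m=1/2^{m-1}$ for odd $m$ and $x_m=0$ for even $m$ ($1\le m\le n-k+1$), and the sum is over all integers $i_1,i_3,\dots,i_{n-k+1}\ge 0$ (odd indices only) such that $i_1+i_3+\cdots+i_{n-k+1}=k$ and $i_1+3i_3+\cdots+(n-k+1)i_{n-k+1}=n$.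
   Context: All generating functions are formal power series in $t$; $x,x_1,x_2,\dots$ are indeterminates (or real numbers). The central incomplete Bell polynomials $T_{n,k}(x_1,\dots,x_{n-k+1})$ ($n\ge k\ge 0$) are defined, for each $k\ge 0$, by $$\frac{1}{k!}\Big(\sum_{m=1}^\infty \frac{1}{2^m}\big(x_m-(-1)^m x_m\big)\frac{t^m}{m!}\Big)^k=\sum_{n=k}^\infty T_{n,k}(x_1,x_2,\dots,x_{n-k+1})\frac{t^n}{n!}.$$ The (exponential) incomplete Bell polynomials $B_{n,k}(x_1,\dots,x_{n-k+1})$ are defined, for each $k\ge 0$, by $$\frac{1}{k!}\Big(\sum_{m=1}^\infty x_m\frac{t^m}{m!}\Big)^k=\sum_{n=k}^\infty B_{n,k}(x_1,\dots,x_{n-k+1})\frac{t^n}{n!}.$$ The central factorial numbers of the second kind $T(n,k)$ are defined, for each $k\ge 0$, by $$\frac{1}{k!}\big(e^{t/2}-e^{-t/2}\big)^k=\sum_{n=k}^\infty T(n,k)\frac{t^n}{n!}.$$ $T_{n,k}(x,x^2,\dots,x^{n-k+1})$ and $T_{n,k}(1,\dots,1)$ denote the values of $T_{n,k}$ at $x_m=x^m$ and at $x_m=1$, respectively. *)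

theory Defs
  imports "HOL-Computational_Algebra.Formal_Power_Series" "HOL-Library.FuncSet"
begin

text \<open>
  The variables \<open>x\<^sub>1, x\<^sub>2, \<dots>\<close> are given as a sequence \<open>x :: nat \<Rightarrow> 'a\<close> over an arbitrary
  field of characteristic 0; \<open>x 0\<close> is never used. The polynomials with indices \<open>n, k\<close> only
  look at \<open>x 1, \<dots>, x (n - k + 1)\<close>, see \<open>bell_cong\<close> and \<open>central_bell_cong\<close> below.
\<close>

definition egf1 :: "(nat \<Rightarrow> 'a::field_char_0) \<Rightarrow> 'a fps" where
  "egf1 x = Abs_fps (\<lambda>m. if m = 0 then 0 else x m / fact m)"

definition bell :: "nat \<Rightarrow> nat \<Rightarrow> (nat \<Rightarrow> 'a::field_char_0) \<Rightarrow> 'a" where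
  "bell n k x = fact n * fps_nth (fps_const (1 / fact k) * egf1 x ^ k) n"

definition central_bell :: "nat \<Rightarrow> nat \<Rightarrow> (nat \<Rightarrow> 'a::field_char_0) \<Rightarrow> 'a" where
  "central_bell n k x =
     fact n * fps_nth (fps_const (1 / fact k) *
       egf1 (\<lambda>m. 1 / 2 ^ m * (x m - (- 1) ^ m * x m)) ^ k) n"

definition central_factorial2 :: "nat \<Rightarrow> nat \<Rightarrow> 'a::field_char_0" where
  "central_factorial2 n k =
     fact n * fps_nth (fps_const (1 / fact k) * (fps_exp (1 / 2) - fps_exp (- (1 / 2))) ^ k) n"

definition odd_upto :: "nat \<Rightarrow> nat set" where
  "odd_upto N = {j \<in> {1..N}. odd j}"

text \<open>
  An index tuple \<open>(i\<^sub>1, i\<^sub>3, \<dots>)\<close> is an extensional function on the odd indices, so that every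
  tuple is represented exactly once.
\<close>
definition odd_tuples :: "nat \<Rightarrow> nat \<Rightarrow> (nat \<Rightarrow> nat) set" where
  "odd_tuples n k =
     {i \<in> odd_upto (n - k + 1) \<rightarrow>\<^sub>E UNIV.
        (\<Sum>j\<in>odd_upto (n - k + 1). i j) = k \<and> (\<Sum>j\<in>odd_upto (n - k + 1). j * i j) = n}"

lemma finite_odd_upto: "finite (odd_upto N)"
  by (simp add: odd_upto_def)

lemma finite_odd_tuples: "finite (odd_tuples n k)"
proof (rule finite_subset)
  show "odd_tuples n k \<subseteq> (odd_upto (n - k + 1) \<rightarrow>\<^sub>E {..k})"
  proof
    fix i assume i: "i \<in> odd_tuples n k"
    have "i j \<le> k" if "j \<in> odd_upto (n - k + 1)" for j
      using i member_le_sum[of j "odd_upto (n - k + 1)" i] that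
      by (auto simp: odd_tuples_def finite_odd_upto)
    then show "i \<in> (odd_upto (n - k + 1) \<rightarrow>\<^sub>E {..k})"
      using i by (auto simp: odd_tuples_def PiE_iff)
  qed
  show "finite (odd_upto (n - k + 1) \<rightarrow>\<^sub>E {..k})"
    by (intro finite_PiE finite_odd_upto) simp
qed

lemma egf1_power_nth_eq_0:
  assumes "n < k"
  shows "fps_nth (egf1 x ^ k) n = 0"
  using assms startsby_zero_power_prefix[of "egf1 x" k] by (simp add: egf1_def)

lemma egf1_power_nth_cong:
  assumes "\<And>m. 1 \<le> m \<Longrightarrow> m \<le> n - k + 1 \<Longrightarrow> x m = y m"
  shows "fps_nth (egf1 x ^ k) n = fps_nth (egf1 y ^ k) n"
  using assms
proof (induction k arbitrary: n)
  case 0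
  then show ?case by simp
next
  case (Suc k)
  show ?case
  proof (cases "n < Suc k")
    case True
    then show ?thesis by (simp only: egf1_power_nth_eq_0)
  next
    case False
    have "fps_nth (egf1 x) i * fps_nth (egf1 x ^ k) (n - i) =
          fps_nth (egf1 y) i * fps_nth (egf1 y ^ k) (n - i)" if "i \<le> n" for i
    proof -
      have "i = 0 \<or> n - i < k \<or> (1 \<le> i \<and> i \<le> n - k \<and> k \<le> n - i)"
        using that False by arith
      then consider "i = 0" | "n - i < k" | "1 \<le> i" "i \<le> n - k" "k \<le> n - i"
        by blast
      then show ?thesis
      proof cases
        case 1
        then show ?thesis by (simp add: egf1_def)
      next
        case 2
        then show ?thesis by (simp add: egf1_power_nth_eq_0)
      next
        case 3
        have "fps_nth (egf1 x ^ k) (n - i) = fps_nth (egf1 y ^ k) (n - i)"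
          using 3 by (intro Suc.IH Suc.prems) auto
        moreover have "x i = y i"
          using 3 False by (intro Suc.prems) auto
        ultimately show ?thesis by (simp add: egf1_def)
      qed
    qed
    then show ?thesis
      by (auto simp: fps_mult_nth intro!: sum.cong)
  qed
qed

lemma bell_cong:
  assumes "\<And>m. 1 \<le> m \<Longrightarrow> m \<le> n - k + 1 \<Longrightarrow> x m = y m"
  shows "bell n k x = bell n k y"
  using egf1_power_nth_cong[of n k x y] assms by (simp add: bell_def)

lemma central_bell_cong:
  fixes x y :: "nat \<Rightarrow> 'a::field_char_0"
  assumes "\<And>m. 1 \<le> m \<Longrightarrow> m \<le> n - k + 1 \<Longrightarrow> x m = y m"
  shows "central_bell n k x = central_bell n k y"
proof -
  let ?f = "\<lambda>z m. 1 / 2 ^ m * (z m - (- 1) ^ m * z m) :: 'a"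
  have "fps_nth (egf1 (?f x) ^ k) n = fps_nth (egf1 (?f y) ^ k) n"
    by (rule egf1_power_nth_cong) (simp add: assms)
  then show ?thesis by (simp add: central_bell_def)
qed

text \<open>The defining generating function identities, with summation starting at \<open>n = k\<close>.\<close>

lemma bell_gf:
  "fps_const (1 / fact k) * egf1 x ^ k =
     Abs_fps (\<lambda>n. if n < k then 0 else bell n k x / fact n)"
  by (rule fps_ext) (simp add: bell_def egf1_power_nth_eq_0)

lemma central_bell_gf:
  "fps_const (1 / fact k) * egf1 (\<lambda>m. 1 / 2 ^ m * (x m - (- 1) ^ m * x m)) ^ k =
     Abs_fps (\<lambda>n. if n < k then 0 else central_bell n k x / fact n)"
  by (rule fps_ext) (simp add: central_bell_def egf1_power_nth_eq_0)

lemma central_factorial2_gf: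
  "fps_const (1 / fact k) * (fps_exp (1 / 2) - fps_exp (- (1 / 2))) ^ k =
     Abs_fps (\<lambda>n. if n < k then 0 else central_factorial2 n k / fact n :: 'a::field_char_0)"
proof (rule fps_ext)
  fix n
  have "fps_nth ((fps_exp (1 / 2) - fps_exp (- (1 / 2)) :: 'a fps) ^ k) n = 0" if "n < k"
    using that
      startsby_zero_power_prefix[of "fps_exp (1 / 2) - fps_exp (- (1 / 2)) :: 'a fps" k]
    by simp
  then show "fps_nth (fps_const (1 / fact k) * (fps_exp (1 / 2) - fps_exp (- (1 / 2))) ^ k) n =
    fps_nth (Abs_fps (\<lambda>n. if n < k then 0 else central_factorial2 n k / fact n :: 'a)) n"
    by (simp add: central_factorial2_def)
qed

end

theory Submission
  imports Defs
begin

text \<open>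
  Substituting \<open>x t\<close> for \<open>t\<close> in the generating function gives the factor \<open>x ^ n\<close>. At \<open>x\<^sub>m = 1\<close>
  the central series is both \<open>e\<^sup>t\<^sup>/\<^sup>2 - e\<^sup>-\<^sup>t\<^sup>/\<^sup>2\<close> and the series of the sequence
  \<open>1, 0, 1/2\<^sup>2, 0, \<dots>\<close>. Its \<open>k\<close>-th power may be truncated after degree \<open>n - k + 1\<close> without
  changing the coefficient of \<open>t ^ n\<close>, which the multinomial theorem then expands.
\<close>

text \<open>Since \<open>(k choose m) / k! = 1 / (m! (k - m)!)\<close>, the divided powers
  \<open>f ^ m / m!\<close> convolve without coefficients. This form is what an induction over
  summands can iterate.\<close>

lemma exponential_binomial_fps:
  fixes f g :: "'a::field_char_0 fps"
  shows "fps_const (1 / fact k) * (f + g) ^ k =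
    (\<Sum>m\<le>k. (fps_const (1 / fact m) * f ^ m) * (fps_const (1 / fact (k - m)) * g ^ (k - m)))"
proof -
  have "fps_const (1 / fact k) * (of_nat (k choose m) * f ^ m * g ^ (k - m)) =
      (fps_const (1 / fact m) * f ^ m) * (fps_const (1 / fact (k - m)) * g ^ (k - m))"
    if "m \<le> k" for m
  proof -
    have "fps_const (1 / fact k) * of_nat (k choose m) =
        fps_const (1 / fact m) * fps_const (1 / fact (k - m) :: 'a)"
      using that by (simp add: fps_of_nat [symmetric] binomial_fact)
    then have "fps_const (1 / fact k) * of_nat (k choose m) * (f ^ m * g ^ (k - m)) =
        fps_const (1 / fact m) * fps_const (1 / fact (k - m) :: 'a) * (f ^ m * g ^ (k - m))"
      by (simp only:)
    then show ?thesis
      by (simp only: mult_ac)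
  qed
  then show ?thesis
    unfolding binomial_ring sum_distrib_left by (intro sum.cong) (simp_all only: atMost_iff)
qed

lemma finite_funcset_sum_eq:
  fixes k :: nat
  assumes "finite S"
  shows "finite {i \<in> S \<rightarrow>\<^sub>E UNIV. sum i S = k}"
proof (rule finite_subset)
  show "{i \<in> S \<rightarrow>\<^sub>E UNIV. sum i S = k} \<subseteq> S \<rightarrow>\<^sub>E {..k}"
    using assms by (auto simp: PiE_iff extensional_def intro: member_le_sum)
  show "finite (S \<rightarrow>\<^sub>E {..k})"
    using assms by (intro finite_PiE) auto
qed

text \<open>Induction on \<open>S\<close>: if the new index \<open>s\<close> takes exponent
  \<open>m\<close>, the old indices share \<open>k - m\<close>, so \<open>k\<close> must stay
  arbitrary.\<close>

lemma exponential_multinomial_fps: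
  fixes f :: "'b \<Rightarrow> 'a::field_char_0 fps"
  assumes "finite S"
  shows "fps_const (1 / fact k) * (\<Sum>j\<in>S. f j) ^ k =
    (\<Sum>i\<in>{i \<in> S \<rightarrow>\<^sub>E UNIV. sum i S = k}. \<Prod>j\<in>S. fps_const (1 / fact (i j)) * f j ^ i j)"
  using assms
proof (induction S arbitrary: k rule: finite_induct)
  case empty
  \<comment> \<open>The only extensional function on the empty set is constantly
    \<open>undefined\<close>; its sum is 0.\<close>
  have "{i \<in> {} \<rightarrow>\<^sub>E (UNIV :: nat set). sum i {} = k} = (if k = 0 then {\<lambda>_ :: 'b. undefined} else {})"
    by auto
  then show ?case by simp
next
  case (insert s S)
  let ?W = "\<lambda>S k. {i \<in> S \<rightarrow>\<^sub>E (UNIV :: nat set). sum i S = k}"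
  let ?g = "\<lambda>j m. fps_const (1 / fact m) * f j ^ m"
  let ?D = "Sigma {..k} (\<lambda>m. ?W S (k - m))"
  let ?h = "\<lambda>(m, i). i(s := m)"
  \<comment> \<open>As \<open>s\<close> is not in \<open>S\<close>, changing the value at
    \<open>s\<close> is invisible to sums and products over \<open>S\<close>.\<close>
  have upd: "sum (i(s := m)) S = sum i S"
    "(\<Prod>j\<in>S. ?g j ((i(s := m)) j)) = (\<Prod>j\<in>S. ?g j (i j))" for i :: "'b \<Rightarrow> nat" and m
    using insert.hyps by (auto intro!: sum.cong prod.cong)
  have image: "?h ` ?D = ?W (insert s S) k"
  proof
    show "?h ` ?D \<subseteq> ?W (insert s S) k"
      using insert.hyps upd(1) by (auto simp: PiE_insert_eq simp del: fun_upd_apply)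
        (simp_all add: upd)
    show "?W (insert s S) k \<subseteq> ?h ` ?D"
    proof
      fix i assume i: "i \<in> ?W (insert s S) k"
      then obtain m j where "i = j(s := m)" "j \<in> S \<rightarrow>\<^sub>E UNIV"
        by (auto simp: PiE_insert_eq simp del: fun_upd_apply)
      moreover from this i have "m + sum j S = k"
        using insert.hyps upd(1)[of j m] by simp
      ultimately show "i \<in> ?h ` ?D"
        by (auto intro!: image_eqI[of _ _ "(m, j)"])
    qed
  qed
  \<comment> \<open>\<open>?D\<close> is a dependent sum, the total left for \<open>i\<close> being
    \<open>k - m\<close>. It lies in the full product, where the update map is injective.\<close>
  have inj: "inj_on ?h ?D"
    by (rule inj_on_subset[OF inj_combinator[OF insert.hyps(2), of "\<lambda>_. UNIV"]]) auto
  have "fps_const (1 / fact k) * (\<Sum>j\<in>insert s S. f j) ^ k =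
      (\<Sum>m\<le>k. ?g s m * (\<Sum>i\<in>?W S (k - m). \<Prod>j\<in>S. ?g j (i j)))"
    using insert.hyps by (simp add: exponential_binomial_fps insert.IH)
  also have "\<dots> = (\<Sum>(m, i)\<in>?D. ?g s m * (\<Prod>j\<in>S. ?g j (i j)))"
    using insert.hyps by (simp add: sum_distrib_left sum.Sigma finite_funcset_sum_eq)
  also have "\<dots> = (\<Sum>p\<in>?D. \<Prod>j\<in>insert s S. ?g j (?h p j))"
    using insert.hyps by (intro sum.cong) (auto simp: upd simp del: fun_upd_apply, simp add: upd)
  also have "\<dots> = (\<Sum>i\<in>?W (insert s S) k. \<Prod>j\<in>insert s S. ?g j (i j))"
    unfolding image[symmetric] sum.reindex[OF inj] by (simp add: o_def)
  finally show ?case .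
qed

lemma prod_monomial_fps:
  fixes c :: "'b \<Rightarrow> 'a::comm_ring_1"
  assumes "finite S"
  shows "(\<Prod>j\<in>S. fps_const (c j) * fps_X ^ e j) = fps_const (\<Prod>j\<in>S. c j) * fps_X ^ (\<Sum>j\<in>S. e j)"
  using assms
  by (induction S rule: finite_induct) (simp_all add: power_add mult_ac flip: fps_const_mult)

text \<open>Restricting to a set \<open>S\<close> outside of which the variables vanish keeps the
  other indices out of the tuples; the odd indices are the case needed below.\<close>

lemma bell_eq_sum:
  fixes x :: "nat \<Rightarrow> 'a::field_char_0"
  assumes S: "S \<subseteq> {1..n - k + 1}" and x: "\<And>m. m \<in> {1..n - k + 1} - S \<Longrightarrow> x m = 0"
  shows "bell n k x =
    (\<Sum>i\<in>{i \<in> S \<rightarrow>\<^sub>E UNIV. (\<Sum>j\<in>S. i j) = k \<and> (\<Sum>j\<in>S. j * i j) = n}.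
      fact n / (\<Prod>j\<in>S. fact (i j)) * (\<Prod>j\<in>S. (x j / fact j) ^ i j))"
proof -
  have fin: "finite S"
    using S finite_subset by blast
  \<comment> \<open>\<open>?y\<close> agrees with \<open>x\<close> on the indices that
    \<open>bell n k\<close> sees, and its generating function is a polynomial.\<close>
  let ?y = "\<lambda>m. if m \<in> S then x m else 0"
  let ?W = "{i \<in> S \<rightarrow>\<^sub>E UNIV. sum i S = k}"
  let ?c = "\<lambda>i. \<Prod>j\<in>S. 1 / fact (i j) * (x j / fact j) ^ i j"
  have egf: "egf1 ?y = (\<Sum>j\<in>S. fps_const (x j / fact j) * fps_X ^ j)"
  proof (rule fps_ext)
    fix m
    show "fps_nth (egf1 ?y) m = fps_nth (\<Sum>j\<in>S. fps_const (x j / fact j) * fps_X ^ j) m"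
      using S fin by (auto simp: egf1_def fps_sum_nth if_distrib sum.delta cong: if_cong)
  qed
  \<comment> \<open>Each tuple contributes one monomial, so taking the coefficient at
    \<open>n\<close> becomes the second constraint on tuples.\<close>
  have "(\<Prod>j\<in>S. fps_const (1 / fact (i j)) * (fps_const (x j / fact j) * fps_X ^ j) ^ i j) =
      fps_const (?c i) * fps_X ^ (\<Sum>j\<in>S. j * i j)" for i
    by (subst prod_monomial_fps[OF fin, symmetric])
      (simp add: power_mult_distrib power_mult flip: mult.assoc)
  then have gf: "fps_const (1 / fact k) * egf1 ?y ^ k =
      (\<Sum>i\<in>?W. fps_const (?c i) * fps_X ^ (\<Sum>j\<in>S. j * i j))"
    unfolding egf exponential_multinomial_fps[OF fin] by simp
  have "bell n k x = bell n k ?y"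
    using x by (intro bell_cong) auto
  also have "\<dots> = fact n * (\<Sum>i\<in>?W. if (\<Sum>j\<in>S. j * i j) = n then ?c i else 0)"
    unfolding bell_def gf by (auto simp: fps_sum_nth intro!: sum.cong)
  also have "\<dots> = (\<Sum>i\<in>?W \<inter> {i. (\<Sum>j\<in>S. j * i j) = n}. fact n * ?c i)"
    using finite_funcset_sum_eq[OF fin] by (simp add: sum.inter_restrict sum_distrib_left if_distrib cong: if_cong)
  also have "\<dots> = (\<Sum>i\<in>{i \<in> S \<rightarrow>\<^sub>E UNIV. (\<Sum>j\<in>S. i j) = k \<and> (\<Sum>j\<in>S. j * i j) = n}.
      fact n / (\<Prod>j\<in>S. fact (i j)) * (\<Prod>j\<in>S. (x j / fact j) ^ i j))"
    by (intro sum.cong) (auto simp: prod.distrib prod_dividef)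
  finally show ?thesis .
qed

text \<open>The factor \<open>x ^ m\<close> comes out of the difference
  \<open>z m - (- 1) ^ m * z m\<close>, and the linear substitution commutes with
  \<open>k\<close>-th powers.\<close>

lemma central_bell_scale:
  fixes x :: "'a::field_char_0"
  shows "central_bell n k (\<lambda>m. x ^ m * y m) = x ^ n * central_bell n k y"
proof -
  let ?f = "\<lambda>z m. 1 / 2 ^ m * (z m - (- 1) ^ m * z m) :: 'a"
  have "egf1 (?f (\<lambda>m. x ^ m * y m)) = egf1 (?f y) oo (fps_const x * fps_X)"
    by (rule fps_ext, simp only: fps_nth_compose_linear) (simp add: egf1_def algebra_simps)
  then have "egf1 (?f (\<lambda>m. x ^ m * y m)) ^ k = egf1 (?f y) ^ k oo (fps_const x * fps_X)"
    by (simp add: fps_compose_power)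
  then show ?thesis
    by (simp add: central_bell_def)
qed

text \<open>Both series have coefficients \<open>((1/2) ^ m - (- 1/2) ^ m) / m!\<close>; at
  \<open>m = 0\<close> this is 0, as \<open>egf1\<close> demands.\<close>

lemma central_bell_one: "central_bell n k (\<lambda>m. 1) = central_factorial2 n k"
proof -
  have "egf1 (\<lambda>m. 1 / 2 ^ m * (1 - (- 1) ^ m * 1)) = fps_exp (1 / 2) - fps_exp (- (1 / 2) :: 'a)"
    by (rule fps_ext) (simp add: egf1_def field_simps power_minus[of "1 / 2"])
  then show ?thesis
    by (simp add: central_bell_def central_factorial2_def)
qed

text \<open>\<open>1 - (- 1) ^ m\<close> is 2 for odd \<open>m\<close> and 0 for even
  \<open>m\<close>, and \<open>2 / 2 ^ m = 1 / 2 ^ (m - 1)\<close>.\<close>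

lemma central_bell_one_eq_bell:
  "central_bell n k (\<lambda>m. 1 :: 'a::field_char_0) =
    bell n k (\<lambda>m. if odd m then 1 / 2 ^ (m - 1) else 0)"
proof -
  have "1 / 2 ^ m * (1 - (- 1) ^ m * 1) = (if odd m then 1 / 2 ^ (m - 1) else 0 :: 'a)" for m
    by (cases m) auto
  then show ?thesis
    by (simp only: central_bell_def bell_def)
qed

theorem corollary2p3:
  fixes x :: "'a::field_char_0" and n k :: nat
  assumes "k \<le> n" and "even (n - k)"
  shows "central_bell n k (\<lambda>m. x ^ m) = x ^ n * central_bell n k (\<lambda>m. 1)
    \<and> central_bell n k (\<lambda>m. 1 :: 'a) = central_factorial2 n k
    \<and> (central_factorial2 n k :: 'a) = bell n k (\<lambda>m. if odd m then 1 / 2 ^ (m - 1) else 0)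
    \<and> bell n k (\<lambda>m. if odd m then 1 / 2 ^ (m - 1) else 0 :: 'a) =
        (\<Sum>i\<in>odd_tuples n k.
           fact n / (\<Prod>j\<in>odd_upto (n - k + 1). fact (i j)) *
           (\<Prod>j\<in>odd_upto (n - k + 1). (1 / (2 ^ (j - 1) * fact j)) ^ i j))"
proof (intro conjI)
  show "central_bell n k (\<lambda>m. x ^ m) = x ^ n * central_bell n k (\<lambda>m. 1)"
    using central_bell_scale[of n k x "\<lambda>m. 1"] by simp
  show "central_bell n k (\<lambda>m. 1 :: 'a) = central_factorial2 n k"
    by (rule central_bell_one)
  show "(central_factorial2 n k :: 'a) = bell n k (\<lambda>m. if odd m then 1 / 2 ^ (m - 1) else 0)"
    by (simp only: central_bell_one_eq_bell flip: central_bell_one)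
  let ?S = "odd_upto (n - k + 1)"
  have "bell n k (\<lambda>m. if odd m then 1 / 2 ^ (m - 1) else 0 :: 'a) =
      (\<Sum>i\<in>odd_tuples n k. fact n / (\<Prod>j\<in>?S. fact (i j)) *
         (\<Prod>j\<in>?S. ((if odd j then 1 / 2 ^ (j - 1) else 0) / fact j) ^ i j))"
    \<comment> \<open>The indices left out of \<open>?S\<close> are even, where the sequence is
      0.\<close>
    unfolding odd_tuples_def by (rule bell_eq_sum) (auto simp: odd_upto_def)
  also have "\<dots> = (\<Sum>i\<in>odd_tuples n k. fact n / (\<Prod>j\<in>?S. fact (i j)) *
         (\<Prod>j\<in>?S. (1 / (2 ^ (j - 1) * fact j)) ^ i j))"
    by (intro sum.cong arg_cong2[where f = "(*)"] prod.cong) (auto simp: odd_upto_def)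
  finally show "bell n k (\<lambda>m. if odd m then 1 / 2 ^ (m - 1) else 0 :: 'a) =
      (\<Sum>i\<in>odd_tuples n k. fact n / (\<Prod>j\<in>?S. fact (i j)) *
         (\<Prod>j\<in>?S. (1 / (2 ^ (j - 1) * fact j)) ^ i j))" .
qed

end
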